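(* Let $G$ be a connected graph of order $n\ge 2$ and let $H$ be a graph of order $n'\ge 2$. If $G$ has no true twin vertices, then the following assertions hold: (i) If $D(H)\le 2$, then $\dim_s(G\circ H)=n\cdot \dim_s(H) + n'\cdot \dim_s(G)-\dim_s(G)\dim_s(H)$. (ii) If $D(H)> 2$, then $\dim_s(G\circ H)=n\cdot \dim_s(K_1+H) + n'\cdot \dim_s(G)-\dim_s(G)\dim_s(K_1+H)$.
   Context: All graphs are simple and undirected. The order of a graph is its number of vertices. $D(H)=\max_{u,v\in V(H)} d_H(u,v)$ is the diameter; if $H$ is not connected, the distance between vertices in different components is infinite and $D(H)=\infty$ (so non-connected $H$ falls under the case $D(H)>2$). Two distinct vertices $x,y$ of $G$ are true twins if $N_G[x]=N_G[y]$, where $N_G[v]=N_G(v)\cup\{v\}$ is the closed neighborhood. "$G$ has no true twin vertices" means that no two distinct vertices of $G$ are true twins. The lexicographic product $G\circ H$ has vertex set $V(G)\times V(H)$, and $(a,b),(c,d)$ are adjacent if and only if either $ac\in E(G)$, or ($a=c$ and $bd\in E(H)$). $K_1+H$ denotes the join of $K_1$ and $H$: the graph obtained from $H$ by adding one new vertex adjacent to every vertex of $H$. For a connected graph $F$, a vertex $w$ strongly resolves two vertices $u,v$ if $d_F(w,u)=d_F(w,v)+d_F(v,u)$ or $d_F(w,v)=d_F(w,u)+d_F(u,v)$. A set $S\subseteq V(F)$ is a strong metric generator for $F$ if every two distinct vertices of $F$ are strongly resolved by some vertex of $S$. The strong metric dimension $\dim_s(F)$ is the smallest cardinality of a strong metric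 generator for $F$. *)

theory Defs
  imports "Graph_Theory.Graph_Theory"
begin

(* A finite simple undirected graph is a pair_graph: a finite, loop-free, symmetric set of
   ordered pairs, so that an edge uv is represented by both arcs (u,v) and (v,u). *)

(* Infimum of the walk lengths; it is infinite if there is no walk from u to v. *)
definition gdist :: "'a pair_pre_digraph \<Rightarrow> 'a \<Rightarrow> 'a \<Rightarrow> ereal" where
  "gdist F u v = wf_digraph.\<mu> (with_proj F) (\<lambda>_. 1) u v"

definition gdiameter :: "'a pair_pre_digraph \<Rightarrow> ereal" where
  "gdiameter F = Max {gdist F u v | u v. u \<in> pverts F \<and> v \<in> pverts F}"

definition closed_neighborhood :: "'a pair_pre_digraph \<Rightarrow> 'a \<Rightarrow> 'a set" where
  "closed_neighborhood F v = {u. (v, u) \<in> parcs F} \<union> {v}"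

definition true_twins :: "'a pair_pre_digraph \<Rightarrow> 'a \<Rightarrow> 'a \<Rightarrow> bool" where
  "true_twins F x y \<longleftrightarrow> x \<in> pverts F \<and> y \<in> pverts F \<and> x \<noteq> y \<and>
     closed_neighborhood F x = closed_neighborhood F y"

definition lex_product ::
    "'a pair_pre_digraph \<Rightarrow> 'b pair_pre_digraph \<Rightarrow> ('a \<times> 'b) pair_pre_digraph" where
  "lex_product G H =
     \<lparr> pverts = pverts G \<times> pverts H,
       parcs = {((a, b), (c, d)) | a b c d.
         a \<in> pverts G \<and> c \<in> pverts G \<and> b \<in> pverts H \<and> d \<in> pverts H \<and>
         ((a, c) \<in> parcs G \<or> (a = c \<and> (b, d) \<in> parcs H))} \<rparr>"

(* The join of K_1 and H: None is the new vertex, and Some embeds H. *)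
definition K1_join :: "'b pair_pre_digraph \<Rightarrow> 'b option pair_pre_digraph" where
  "K1_join H =
     \<lparr> pverts = insert None (Some ` pverts H),
       parcs = {(Some u, Some v) | u v. (u, v) \<in> parcs H} \<union>
               {(None, Some v) | v. v \<in> pverts H} \<union>
               {(Some v, None) | v. v \<in> pverts H} \<rparr>"

definition strongly_resolves :: "'a pair_pre_digraph \<Rightarrow> 'a \<Rightarrow> 'a \<Rightarrow> 'a \<Rightarrow> bool" where
  "strongly_resolves F w u v \<longleftrightarrow>
     gdist F w u = gdist F w v + gdist F v u \<or> gdist F w v = gdist F w u + gdist F u v"

definition strong_metric_generator :: "'a pair_pre_digraph \<Rightarrow> 'a set \<Rightarrow> bool" where
  "strong_metric_generator F S \<longleftrightarrow> S \<subseteq> pverts F \<and>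
     (\<forall>u\<in>pverts F. \<forall>v\<in>pverts F. u \<noteq> v \<longrightarrow> (\<exists>w\<in>S. strongly_resolves F w u v))"

(* Only meaningful for connected F. *)
definition strong_metric_dim :: "'a pair_pre_digraph \<Rightarrow> nat" where
  "strong_metric_dim F = (LEAST k. \<exists>S. strong_metric_generator F S \<and> card S = k)"

lemma gdist_eq_INF_length:
  assumes "pair_graph F"
  shows "gdist F u v =
    (INF p\<in>{p. pre_digraph.awalk (with_proj F) u p v}. ereal (real (length p)))"
proof -
  interpret pair_graph F by fact
  have "awalk_cost (\<lambda>_. 1) p = real (length p)" for p
    by (induction p) auto
  then show ?thesis unfolding gdist_def \<mu>_def by simp
qed

lemma pair_graph_lex_product:
  assumes "pair_graph G" "pair_graph H"
  shows "pair_graph (lex_product G H)"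
proof -
  interpret G: pair_graph G by fact
  interpret H: pair_graph H by fact
  have "parcs (lex_product G H) \<subseteq> (pverts G \<times> pverts H) \<times> (pverts G \<times> pverts H)"
    by (auto simp: lex_product_def)
  then have "finite (parcs (lex_product G H))"
    by (rule finite_subset) (auto simp: G.pair_finite_verts H.pair_finite_verts)
  then show ?thesis
    by unfold_locales
       (auto simp: lex_product_def symmetric_def sym_def
         dest: G.arcs_symmetric H.arcs_symmetric G.no_loops' H.no_loops')
qed

lemma pair_graph_K1_join:
  assumes "pair_graph H"
  shows "pair_graph (K1_join H)"
proof -
  interpret H: pair_graph H by fact
  have "parcs (K1_join H) \<subseteq> insert None (Some ` pverts H) \<times> insert None (Some ` pverts H)"
    by (auto simp: K1_join_def dest: H.wellformed')
  then have "finite (parcs (K1_join H))"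
    by (rule finite_subset) auto
  then show ?thesis
    by unfold_locales
       (auto simp: K1_join_def symmetric_def sym_def
         dest: H.wellformed' H.arcs_symmetric H.no_loops')
qed

end

theory Submission
  imports Defs
begin

text \<open>Two distinct vertices are mutually maximally distant if neither has a neighbour that is farther
  from the other one. In a connected graph, the only vertices that strongly resolve such a pair are
  its two members. Conversely, any two distinct vertices lie on a geodesic between some mutually
  maximally distant pair, and both ends of it strongly resolve them. Hence the strong metric generators are the
  vertex covers of the relation of mutual maximal distance (the edges of the strong resolving
  graph), and by complementation the strong metric dimension is the order minus the
  independence number \<open>\<alpha>\<close> of that relation (\<open>strong_metric_dim_eq\<close>).

  In \<open>G \<circ> H\<close>, two vertices of different fibres are as far apart as their projections to \<open>G\<close>, and
  two vertices of one fibre are at distance at most two, through any neighbouring fibre. Since \<open>G\<close> has no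
  true twins, mutually maximally distant vertices of \<open>G\<close> are never adjacent; it follows that two
  vertices in different fibres are mutually maximally distant exactly if their projections are.
  Within a fibre the relation is \<open>nonadjacent_or_twins\<close>: two distinct vertices of \<open>H\<close> that are
  nonadjacent or true twins (\<open>mutually_max_distant_lex_product\<close>). The resulting relation is a
  lexicographic product of relations, and the independence number is multiplicative for these
  (\<open>independence_number_lex\<close>), so that
  \<open>dim (G \<circ> H) = n n' - \<alpha>\<^sub>G \<alpha>\<^sub>H = n n' - (n - dim G) (n' - k)\<close> with \<open>k = n' - \<alpha>\<^sub>H\<close>,
  where \<open>\<alpha>\<^sub>H\<close> is the independence number of \<open>nonadjacent_or_twins\<close> on \<open>H\<close>.

  It remains to recognise \<open>k\<close>. In every graph of diameter at most two, mutual maximal distance coincides with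
  \<open>nonadjacent_or_twins\<close>. This applies to \<open>H\<close> if its diameter is at most two, so that
  \<open>k = dim H\<close>. It always applies to \<open>K\<^sub>1 + H\<close>; if \<open>H\<close> has diameter greater than two, no vertex
  of \<open>H\<close> dominates \<open>H\<close>, the new vertex has no twin, and the order and the independence number both
  grow by one, so that \<open>k = dim (K\<^sub>1 + H)\<close>.\<close>

section \<open>Distances as natural numbers\<close>

text \<open>The least element of the empty set of lengths is arbitrary, so this is a distance only between
  vertices that are joined by a walk.\<close>

definition hop_dist :: "'a pair_pre_digraph \<Rightarrow> 'a \<Rightarrow> 'a \<Rightarrow> nat" where
  "hop_dist F u v = (LEAST k. \<exists>p. pre_digraph.awalk (with_proj F) u p v \<and> length p = k)"

locale connected_pair_graph = pair_graph +
  assumes linked: "u \<in> pverts G \<Longrightarrow> v \<in> pverts G \<Longrightarrow> \<exists>p. awalk u p v"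
begin

lemma shortest_walk:
  assumes "u \<in> pverts G" "v \<in> pverts G"
  obtains p where "awalk u p v" "length p = hop_dist G u v"
proof -
  have "\<exists>k p. awalk u p v \<and> length p = k" using linked[OF assms] by blast
  from LeastI_ex[OF this] that show thesis unfolding hop_dist_def by blast
qed

lemma hop_dist_le_length: "awalk u p v \<Longrightarrow> hop_dist G u v \<le> length p"
  unfolding hop_dist_def by (rule Least_le) blast

lemma gdist_eq_hop_dist:
  assumes "u \<in> pverts G" "v \<in> pverts G"
  shows "gdist G u v = ereal (real (hop_dist G u v))"
proof -
  obtain p where p: "awalk u p v" "length p = hop_dist G u v"
    using shortest_walk[OF assms] .
  show ?thesis unfolding gdist_eq_INF_length[OF pair_graph]
  proof (rule antisym)
    show "(INF p\<in>{p. awalk u p v}. ereal (real (length p))) \<le> ereal (real (hop_dist G u v))"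
      using p by (intro INF_lower2[of p]) auto
    show "ereal (real (hop_dist G u v)) \<le> (INF p\<in>{p. awalk u p v}. ereal (real (length p)))"
      by (intro INF_greatest) (auto dest: hop_dist_le_length)
  qed
qed

lemma hop_dist_refl: "u \<in> pverts G \<Longrightarrow> hop_dist G u u = 0"
  using hop_dist_le_length[of u "[]" u] by (simp add: awalk_Nil_iff)

lemma hop_dist_pos: "u \<in> pverts G \<Longrightarrow> v \<in> pverts G \<Longrightarrow> u \<noteq> v \<Longrightarrow> hop_dist G u v > 0"
  by (metis shortest_walk awalk_Nil_iff length_0_conv gr0I)

lemma hop_dist_triangle:
  assumes "u \<in> pverts G" "v \<in> pverts G" "w \<in> pverts G"
  shows "hop_dist G u w \<le> hop_dist G u v + hop_dist G v w"
proof -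
  obtain p q where "awalk u p v" "length p = hop_dist G u v"
    and "awalk v q w" "length q = hop_dist G v w"
    using shortest_walk assms by metis
  then show ?thesis using hop_dist_le_length[of u "p @ q" w] by auto
qed

lemma hop_dist_commute:
  assumes "u \<in> pverts G" "v \<in> pverts G"
  shows "hop_dist G u v = hop_dist G v u"
proof -
  have len: "length (rev_path p) = length p" for p :: "('a \<times> 'a) list"
    by (induction p) auto
  have "hop_dist G y x \<le> hop_dist G x y" if "x \<in> pverts G" "y \<in> pverts G" for x y
    using shortest_walk[OF that] hop_dist_le_length[of y _ x] len by (metis awalk_rev_path)
  then show ?thesis using assms by (simp add: antisym)
qed

lemma hop_dist_arc: "(u, v) \<in> parcs G \<Longrightarrow> hop_dist G u v \<le> 1"
  using hop_dist_le_length[of u "[(u, v)]" v] wellformed' by (simp add: awalk_simps)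

lemma first_step:
  assumes "u \<in> pverts G" "v \<in> pverts G" "u \<noteq> v"
  obtains w where "(u, w) \<in> parcs G" "hop_dist G u v = Suc (hop_dist G w v)"
proof -
  obtain p where p: "awalk u p v" "length p = hop_dist G u v"
    using shortest_walk assms by blast
  with assms obtain e q where [simp]: "p = e # q" by (cases p) (auto simp: awalk_Nil_iff)
  obtain w where e: "e = (u, w)" "(u, w) \<in> parcs G" "awalk w q v"
    using p by (cases e) (auto simp: awalk_Cons_iff)
  have "hop_dist G u v \<le> hop_dist G u w + hop_dist G w v"
    using hop_dist_triangle e assms wellformed' by blast
  then have "hop_dist G u v = Suc (hop_dist G w v)"
    using hop_dist_arc[OF e(2)] hop_dist_le_length[OF e(3)] p by simp
  then show thesis using that e by blast
qed

lemma hop_dist_le_1_iff: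
  assumes "u \<in> pverts G" "v \<in> pverts G"
  shows "hop_dist G u v \<le> 1 \<longleftrightarrow> u = v \<or> (u, v) \<in> parcs G"
proof
  assume "hop_dist G u v \<le> 1"
  show "u = v \<or> (u, v) \<in> parcs G"
  proof (cases "u = v")
    case False
    obtain w where "(u, w) \<in> parcs G" "hop_dist G u v = Suc (hop_dist G w v)"
      using first_step[OF assms False] .
    then show ?thesis
      using \<open>hop_dist G u v \<le> 1\<close> hop_dist_pos[of w v] wellformed' assms by fastforce
  qed simp
qed (use assms hop_dist_arc hop_dist_refl in auto)

end

lemma (in pair_graph) connected_imp_connected_pair_graph:
  assumes "connected G"
  shows "connected_pair_graph G"
proof
  fix u v assume "u \<in> pverts G" "v \<in> pverts G"
  moreover have "strongly_connected G"
    using symmetric_connected_imp_strongly_connected pair_sym_arcs assms by blast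
  ultimately show "\<exists>p. awalk u p v"
    by (simp add: strongly_connected_def reachable_awalk)
qed

text \<open>The tool by which the distances of the constructed graphs are determined. If \<open>f u v\<close> grows by
  at most one with each step away from \<open>v\<close>, then no walk to \<open>v\<close> is shorter than \<open>f\<close> predicts; if
  \<open>f\<close> can be decreased by a step from every vertex other than \<open>v\<close>, greedy descent gives a walk
  that attains this bound. The descent also shows that the graph is connected.\<close>

lemma (in pair_graph) hop_dist_unique:
  assumes root: "\<And>v. v \<in> pverts G \<Longrightarrow> f v v = 0"
    and slope: "\<And>u w v. (u, w) \<in> parcs G \<Longrightarrow> v \<in> pverts G \<Longrightarrow> f u v \<le> Suc (f w v)"
    and descent: "\<And>u v. u \<in> pverts G \<Longrightarrow> v \<in> pverts G \<Longrightarrow> u \<noteq> v \<Longrightarrow>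
      \<exists>w. (u, w) \<in> parcs G \<and> f w v < f u v"
  shows "connected_pair_graph G"
    and "u \<in> pverts G \<Longrightarrow> v \<in> pverts G \<Longrightarrow> hop_dist G u v = f u v"
proof -
  have greedy: "\<exists>p. awalk u p v \<and> length p \<le> f u v" if "u \<in> pverts G" "v \<in> pverts G" for u v
    using that
  proof (induction "f u v" arbitrary: u rule: less_induct)
    case less
    show ?case
    proof (cases "u = v")
      case True
      then show ?thesis using less by (intro exI[of _ "[]"]) (simp add: awalk_Nil_iff)
    next
      case False
      then obtain w where w: "(u, w) \<in> parcs G" "f w v < f u v"
        using descent less.prems by blast
      then obtain p where "awalk w p v" "length p \<le> f w v"
        using less.hyps less.prems wellformed' by blast
      with w show ?thesis by (intro exI[of _ "(u, w) # p"]) (simp add: awalk_Cons_iff)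
    qed
  qed
  show conn: "connected_pair_graph G"
    by unfold_locales (use greedy in blast)
  interpret connected_pair_graph G by (fact conn)
  have lower: "f u v \<le> length p" if "awalk u p v" for u p v
    using that
  proof (induction p arbitrary: u)
    case Nil
    then show ?case using root by (auto simp: awalk_Nil_iff)
  next
    case (Cons e p)
    then have "e \<in> parcs G" "fst e = u" "awalk (snd e) p v"
      by (auto simp: awalk_Cons_iff)
    moreover have "v \<in> pverts G" using Cons.prems by auto
    ultimately show ?case using slope[of "fst e" "snd e" v] Cons.IH by fastforce
  qed
  show "hop_dist G u v = f u v" if "u \<in> pverts G" "v \<in> pverts G"
    by (metis antisym greedy[OF that] hop_dist_le_length le_trans lower shortest_walk[OF that])
qed

section \<open>Strong metric generators and mutually maximally distant vertices\<close>

definition mutually_max_distant :: "'a pair_pre_digraph \<Rightarrow> 'a \<Rightarrow> 'a \<Rightarrow> bool" where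
  "mutually_max_distant F u v \<longleftrightarrow> u \<noteq> v \<and>
     (\<forall>w. (u, w) \<in> parcs F \<longrightarrow> hop_dist F w v \<le> hop_dist F u v) \<and>
     (\<forall>w. (v, w) \<in> parcs F \<longrightarrow> hop_dist F u w \<le> hop_dist F u v)"

definition independent_sets :: "'a set \<Rightarrow> ('a \<Rightarrow> 'a \<Rightarrow> bool) \<Rightarrow> 'a set set" where
  "independent_sets V R = {I. I \<subseteq> V \<and> (\<forall>x\<in>I. \<forall>y\<in>I. \<not> R x y)}"

definition independence_number :: "'a set \<Rightarrow> ('a \<Rightarrow> 'a \<Rightarrow> bool) \<Rightarrow> nat" where
  "independence_number V R = Max (card ` independent_sets V R)"

lemma finite_independent_sets: "finite V \<Longrightarrow> finite (independent_sets V R)"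
  by (rule finite_subset[of _ "Pow V"]) (auto simp: independent_sets_def)

lemma empty_independent: "{} \<in> independent_sets V R"
  by (simp add: independent_sets_def)

lemma independence_number_ge:
  "finite V \<Longrightarrow> I \<in> independent_sets V R \<Longrightarrow> card I \<le> independence_number V R"
  unfolding independence_number_def by (simp add: finite_independent_sets)

lemma independence_number_attained:
  assumes "finite V"
  obtains I where "I \<in> independent_sets V R" "card I = independence_number V R"
proof -
  have "independence_number V R \<in> card ` independent_sets V R"
    unfolding independence_number_def using assms empty_independent
    by (intro Max_in) (auto simp: finite_independent_sets)
  with that show thesis by auto
qed

lemma independence_number_le_card: "finite V \<Longrightarrow> independence_number V R \<le> card V"
  by (metis (no_types, lifting) card_mono independence_number_attained independent_sets_def
      mem_Collect_eq)

lemma independence_number_cong: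
  assumes "\<And>x y. x \<in> V \<Longrightarrow> y \<in> V \<Longrightarrow> R x y \<longleftrightarrow> R' x y"
  shows "independence_number V R = independence_number V R'"
proof -
  have "independent_sets V R = independent_sets V R'"
    unfolding independent_sets_def using assms by blast
  then show ?thesis by (simp add: independence_number_def)
qed

context connected_pair_graph
begin

lemma strongly_resolves_iff:
  assumes "w \<in> pverts G" "u \<in> pverts G" "v \<in> pverts G"
  shows "strongly_resolves G w u v \<longleftrightarrow>
    hop_dist G w u = hop_dist G w v + hop_dist G v u \<or>
    hop_dist G w v = hop_dist G w u + hop_dist G u v"
  using assms by (simp add: strongly_resolves_def gdist_eq_hop_dist flip: of_nat_add)

text \<open>If a geodesic from \<open>u\<close> through \<open>v\<close> continued to some \<open>w \<noteq> v\<close>, its next vertex after \<open>v\<close> would be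
  a neighbour of \<open>v\<close> farther from \<open>u\<close>.\<close>

lemma max_distant_resolver:
  assumes V: "w \<in> pverts G" "u \<in> pverts G" "v \<in> pverts G"
    and max: "\<And>x. (v, x) \<in> parcs G \<Longrightarrow> hop_dist G u x \<le> hop_dist G u v"
    and eq: "hop_dist G w u = hop_dist G w v + hop_dist G v u"
  shows "w = v"
proof (rule ccontr)
  assume "w \<noteq> v"
  then obtain x where x: "(v, x) \<in> parcs G" "hop_dist G v w = Suc (hop_dist G x w)"
    using first_step[of v w] V by metis
  have "hop_dist G w u \<le> hop_dist G w x + hop_dist G x u"
    using hop_dist_triangle V x wellformed' by blast
  then show False
    using max[OF x(1)] x eq hop_dist_commute V wellformed'(2)[OF x(1)] by simp
qed

lemma mutually_max_distant_resolver:
  assumes "w \<in> pverts G" "u \<in> pverts G" "v \<in> pverts G"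
    and mmd: "mutually_max_distant G u v" and "strongly_resolves G w u v"
  shows "w = u \<or> w = v"
proof -
  have 1: "hop_dist G u x \<le> hop_dist G u v" if "(v, x) \<in> parcs G" for x
    using mmd that by (simp add: mutually_max_distant_def)
  have 2: "hop_dist G v x \<le> hop_dist G v u" if "(u, x) \<in> parcs G" for x
    using mmd that assms(2,3) wellformed'[OF that]
    by (simp add: mutually_max_distant_def hop_dist_commute[of v])
  show ?thesis
    using assms(5) max_distant_resolver[OF assms(1,2,3) 1] max_distant_resolver[OF assms(1,3,2) 2]
    unfolding strongly_resolves_iff[OF assms(1-3)] by blast
qed

text \<open>A longest geodesic that passes through \<open>u\<close> and then \<open>v\<close> cannot be prolonged at either end, so its
  ends are mutually maximally distant.\<close>

lemma extend_to_mutually_max_distant: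
  assumes V: "u \<in> pverts G" "v \<in> pverts G" and "u \<noteq> v"
  obtains x y where "x \<in> pverts G" "y \<in> pverts G" "mutually_max_distant G x y"
    "hop_dist G x y = hop_dist G x u + hop_dist G u v + hop_dist G v y"
proof -
  define P where "P = {(x, y). x \<in> pverts G \<and> y \<in> pverts G \<and>
    hop_dist G x y = hop_dist G x u + hop_dist G u v + hop_dist G v y}"
  have "P \<subseteq> pverts G \<times> pverts G" by (auto simp: P_def)
  then have "finite P" by (rule finite_subset) (simp add: pair_finite_verts)
  moreover have "(u, v) \<in> P" using V by (simp add: P_def hop_dist_refl)
  ultimately have "Max (case_prod (hop_dist G) ` P) \<in> case_prod (hop_dist G) ` P"
    by (intro Max_in) auto
  then obtain x y where "(x, y) \<in> P"
    and xy_max: "hop_dist G x y = Max (case_prod (hop_dist G) ` P)"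
    by auto
  then have xy: "x \<in> pverts G" "y \<in> pverts G"
      "hop_dist G x y = hop_dist G x u + hop_dist G u v + hop_dist G v y"
    by (auto simp: P_def)
  have max: "hop_dist G x' y' \<le> hop_dist G x y" if "(x', y') \<in> P" for x' y'
    unfolding xy_max using \<open>finite P\<close> that by (intro Max_ge) force+
  have "x \<noteq> y" using xy hop_dist_pos[OF V \<open>u \<noteq> v\<close>] by (auto simp: hop_dist_refl)
  \<comment> \<open>A neighbour that is farther away would again lie on a geodesic through both given vertices.\<close>
  moreover have "hop_dist G w y \<le> hop_dist G x y" if w: "(x, w) \<in> parcs G" for w
  proof (rule ccontr)
    assume "\<not> ?thesis"
    moreover have "w \<in> pverts G" using w wellformed' by blast
    moreover have "hop_dist G w u \<le> Suc (hop_dist G x u)"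
      using hop_dist_triangle[of w x u] hop_dist_arc[of w x] arcs_symmetric[OF w] xy V \<open>w \<in> pverts G\<close>
      by simp
    moreover have "hop_dist G w y \<le> hop_dist G w u + hop_dist G u v + hop_dist G v y"
      using hop_dist_triangle[of w u y] hop_dist_triangle[of u v y] xy V \<open>w \<in> pverts G\<close> by simp
    ultimately have "(w, y) \<in> P" using xy by (simp add: P_def)
    with max \<open>\<not> ?thesis\<close> show False by blast
  qed
  moreover have "hop_dist G x w \<le> hop_dist G x y" if w: "(y, w) \<in> parcs G" for w
  proof (rule ccontr)
    assume "\<not> ?thesis"
    moreover have "w \<in> pverts G" using w wellformed' by blast
    moreover have "hop_dist G v w \<le> Suc (hop_dist G v y)"
      using hop_dist_triangle[of v y w] hop_dist_arc[OF w] xy V \<open>w \<in> pverts G\<close> by simp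
    moreover have "hop_dist G x w \<le> hop_dist G x u + hop_dist G u v + hop_dist G v w"
      using hop_dist_triangle[of x u w] hop_dist_triangle[of u v w] xy V \<open>w \<in> pverts G\<close> by simp
    ultimately have "(x, w) \<in> P" using xy by (simp add: P_def)
    with max \<open>\<not> ?thesis\<close> show False by blast
  qed
  ultimately show thesis using that xy by (simp add: mutually_max_distant_def)
qed

text \<open>Strong metric generators are the vertex covers of the strong resolving graph, stated here for
  the complements of the covers.\<close>

lemma strong_metric_generator_iff_independent:
  assumes S: "S \<subseteq> pverts G"
  shows "strong_metric_generator G S \<longleftrightarrow>
    pverts G - S \<in> independent_sets (pverts G) (mutually_max_distant G)"
proof
  assume gen: "strong_metric_generator G S"
  have "\<not> mutually_max_distant G u v" if uv: "u \<in> pverts G - S" "v \<in> pverts G - S" for u v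
  proof
    assume mmd: "mutually_max_distant G u v"
    then have "u \<noteq> v" by (simp add: mutually_max_distant_def)
    then obtain w where "w \<in> S" "strongly_resolves G w u v"
      using gen uv unfolding strong_metric_generator_def by blast
    then show False using mutually_max_distant_resolver[of w u v] mmd uv S by blast
  qed
  then show "pverts G - S \<in> independent_sets (pverts G) (mutually_max_distant G)"
    by (simp add: independent_sets_def)
next
  assume ind: "pverts G - S \<in> independent_sets (pverts G) (mutually_max_distant G)"
  have "\<exists>w\<in>S. strongly_resolves G w u v" if uv: "u \<in> pverts G" "v \<in> pverts G" "u \<noteq> v" for u v
  proof -
    obtain x y where xy: "x \<in> pverts G" "y \<in> pverts G" "mutually_max_distant G x y"
      and eq: "hop_dist G x y = hop_dist G x u + hop_dist G u v + hop_dist G v y"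
      using extend_to_mutually_max_distant uv by blast
    have "x \<in> S \<or> y \<in> S" using ind xy by (auto simp: independent_sets_def)
    moreover have "strongly_resolves G x u v"
      using hop_dist_triangle[of x v y] hop_dist_triangle[of x u v] eq xy uv
      by (simp add: strongly_resolves_iff)
    moreover have "strongly_resolves G y u v"
      using hop_dist_triangle[of x u y] hop_dist_triangle[of u v y] eq xy uv
      by (simp add: strongly_resolves_iff hop_dist_commute[of y] hop_dist_commute[of v u])
    ultimately show ?thesis by blast
  qed
  then show "strong_metric_generator G S" using S by (simp add: strong_metric_generator_def)
qed

text \<open>At distance one, no neighbour of either vertex being farther away means that every neighbour of
  one belongs to the closed neighbourhood of the other. This is where the absence of true twins
  enters: it keeps mutually maximally distant vertices apart.\<close>

lemma adjacent_mutually_max_distant_twins: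
  assumes uv: "(u, v) \<in> parcs G" and mmd: "mutually_max_distant G u v"
  shows "true_twins G u v"
proof -
  have V: "u \<in> pverts G" "v \<in> pverts G" and vu: "(v, u) \<in> parcs G"
    using uv wellformed' arcs_symmetric by blast+
  have "w = v \<or> (v, w) \<in> parcs G" if w: "(u, w) \<in> parcs G" for w
  proof -
    have "hop_dist G w v \<le> 1"
      using mmd w hop_dist_arc[OF uv] unfolding mutually_max_distant_def by fastforce
    then show ?thesis using hop_dist_le_1_iff V w wellformed' arcs_symmetric by blast
  qed
  moreover have "w = u \<or> (u, w) \<in> parcs G" if w: "(v, w) \<in> parcs G" for w
  proof -
    have "hop_dist G u w \<le> 1"
      using mmd w hop_dist_arc[OF uv] unfolding mutually_max_distant_def by fastforce
    then show ?thesis using hop_dist_le_1_iff V w wellformed' by blast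
  qed
  ultimately have "closed_neighborhood G u = closed_neighborhood G v"
    using uv vu by (auto simp: closed_neighborhood_def)
  then show ?thesis using V mmd by (simp add: true_twins_def mutually_max_distant_def)
qed

lemma strong_metric_dim_eq:
  "strong_metric_dim G = card (pverts G) - independence_number (pverts G) (mutually_max_distant G)"
  (is "_ = card ?V - ?\<alpha>")
  unfolding strong_metric_dim_def
proof (rule Least_equality)
  obtain I where I: "I \<in> independent_sets ?V (mutually_max_distant G)" "card I = ?\<alpha>"
    using independence_number_attained pair_finite_verts by blast
  then have "I \<subseteq> ?V" by (simp add: independent_sets_def)
  then have "?V - (?V - I) = I" by blast
  then have "strong_metric_generator G (?V - I)"
    using I by (simp add: strong_metric_generator_iff_independent)
  moreover have "card (?V - I) = card ?V - ?\<alpha>"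
    using I \<open>I \<subseteq> ?V\<close> by (simp add: card_Diff_subset finite_subset[OF _ pair_finite_verts])
  ultimately show "\<exists>S. strong_metric_generator G S \<and> card S = card ?V - ?\<alpha>" by blast
next
  fix k assume "\<exists>S. strong_metric_generator G S \<and> card S = k"
  then obtain S where S: "strong_metric_generator G S" "card S = k" by blast
  then have "S \<subseteq> ?V" by (simp add: strong_metric_generator_def)
  then have "card (?V - S) \<le> ?\<alpha>"
    using S strong_metric_generator_iff_independent independence_number_ge pair_finite_verts by blast
  then show "card ?V - ?\<alpha> \<le> k"
    using S \<open>S \<subseteq> ?V\<close> by (simp add: card_Diff_subset finite_subset[OF _ pair_finite_verts])
qed

end

section \<open>Independent sets of a lexicographic combination of relations\<close>

text \<open>An independent set projects to an independent set of \<open>R\<close>, and each of its fibres is independent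
  for \<open>T\<close>; conversely, products of independent sets are independent. Irreflexivity of \<open>R\<close> keeps two
  points of one fibre from being related through their first components.\<close>

lemma independence_number_lex:
  assumes fin: "finite A" "finite B" and irrefl: "\<And>a. a \<in> A \<Longrightarrow> \<not> R a a"
  shows "independence_number (A \<times> B) (\<lambda>(a, b) (c, d). R a c \<or> (a = c \<and> T b d)) =
    independence_number A R * independence_number B T" (is "independence_number _ ?L = _")
proof (rule antisym)
  obtain I where I: "I \<in> independent_sets (A \<times> B) ?L" "card I = independence_number (A \<times> B) ?L"
    using independence_number_attained[OF finite_cartesian_product[OF fin]] .
  have sub: "I \<subseteq> A \<times> B" using I by (simp add: independent_sets_def)
  have nR: "\<not> R a c" and nT: "a = c \<Longrightarrow> \<not> T b d" if "(a, b) \<in> I" "(c, d) \<in> I" for a b c d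
    using I that unfolding independent_sets_def by blast+
  have "finite I" using sub fin finite_subset finite_cartesian_product by metis
  have "card I = card (SIGMA a:fst ` I. I `` {a})"
    by (rule arg_cong[of _ _ card]) force
  also have "\<dots> = (\<Sum>a\<in>fst ` I. card (I `` {a}))"
    using \<open>finite I\<close> by (simp add: card_SigmaI finite_Image)
  also have "\<dots> \<le> (\<Sum>a\<in>fst ` I. independence_number B T)"
  proof (intro sum_mono independence_number_ge fin)
    fix a
    show "I `` {a} \<in> independent_sets B T"
      using sub nT by (auto simp: independent_sets_def)
  qed
  also have "\<dots> = card (fst ` I) * independence_number B T" by simp
  also have "\<dots> \<le> independence_number A R * independence_number B T"
  proof (intro mult_right_mono independence_number_ge fin)
    show "fst ` I \<in> independent_sets A R"
      using sub nR by (auto simp: independent_sets_def)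
  qed simp
  finally show "independence_number (A \<times> B) ?L \<le> independence_number A R * independence_number B T"
    using I by simp
next
  obtain I where I: "I \<in> independent_sets A R" "card I = independence_number A R"
    using independence_number_attained[OF fin(1)] .
  obtain J where J: "J \<in> independent_sets B T" "card J = independence_number B T"
    using independence_number_attained[OF fin(2)] .
  from I J have "I \<times> J \<in> independent_sets (A \<times> B) ?L"
    by (auto simp: independent_sets_def)
  then have "card (I \<times> J) \<le> independence_number (A \<times> B) ?L"
    by (intro independence_number_ge) (use fin in auto)
  then show "independence_number A R * independence_number B T \<le> independence_number (A \<times> B) ?L"
    using I J by (simp add: card_cartesian_product)
qed

section \<open>Graphs of diameter at most two\<close>

text \<open>Mutual maximal distance expressed by adjacency alone, as it appears in graphs of diameter at
  most two and in the fibres of a lexicographic product.\<close>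

definition nonadjacent_or_twins :: "'a pair_pre_digraph \<Rightarrow> 'a \<Rightarrow> 'a \<Rightarrow> bool" where
  "nonadjacent_or_twins F u v \<longleftrightarrow> u \<noteq> v \<and>
     ((u, v) \<in> parcs F \<longrightarrow> closed_neighborhood F u = closed_neighborhood F v)"

text \<open>The distance of a graph of diameter at most two. It is also used for graphs of larger
  diameter, where it is the distance truncated at two: this is how far apart two vertices are once
  some outside vertex is adjacent to everything, as in a fibre of the product.\<close>

definition two_step_dist :: "'a pair_pre_digraph \<Rightarrow> 'a \<Rightarrow> 'a \<Rightarrow> nat" where
  "two_step_dist F u v = (if u = v then 0 else if (u, v) \<in> parcs F then 1 else 2)"

text \<open>Nonadjacent vertices already have the largest possible value; for adjacent ones the value is one,
  and the condition says that the closed neighbourhoods contain each other. Stated for the truncated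
  distance, this serves both the graphs of diameter two and the fibres over an arbitrary \<open>H\<close>.\<close>

lemma (in pair_graph) two_step_dist_max_iff:
  assumes V: "u \<in> pverts G" "v \<in> pverts G"
  shows "u \<noteq> v \<and>
      (\<forall>w. (u, w) \<in> parcs G \<longrightarrow> two_step_dist G w v \<le> two_step_dist G u v) \<and>
      (\<forall>w. (v, w) \<in> parcs G \<longrightarrow> two_step_dist G u w \<le> two_step_dist G u v) \<longleftrightarrow>
    nonadjacent_or_twins G u v"
proof (cases "u \<noteq> v \<and> (u, v) \<in> parcs G")
  case True
  have le1: "two_step_dist G x y \<le> 1 \<longleftrightarrow> y \<in> closed_neighborhood G x" for x y
    by (auto simp: two_step_dist_def closed_neighborhood_def)
  have le1': "two_step_dist G x y \<le> 1 \<longleftrightarrow> x \<in> closed_neighborhood G y" for x y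
    using arcs_symmetric by (auto simp: two_step_dist_def closed_neighborhood_def)
  have sub: "(\<forall>w. (x, w) \<in> parcs G \<longrightarrow> w \<in> closed_neighborhood G y) \<longleftrightarrow>
      closed_neighborhood G x \<subseteq> closed_neighborhood G y"
    if "(x, y) \<in> parcs G" for x y
    using arcs_symmetric[OF that] by (auto simp: closed_neighborhood_def)
  have "two_step_dist G u v = 1" using True by (simp add: two_step_dist_def)
  then show ?thesis
    unfolding nonadjacent_or_twins_def
    using True le1[of u] le1'[of _ v] sub[of u v] sub[of v u] arcs_symmetric[of u v] by auto
next
  case False
  then show ?thesis by (auto simp: two_step_dist_def nonadjacent_or_twins_def)
qed

text \<open>A form of "diameter at most two" that mentions only adjacency.\<close>

definition common_neighbors :: "'a pair_pre_digraph \<Rightarrow> bool" where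
  "common_neighbors F \<longleftrightarrow> (\<forall>u\<in>pverts F. \<forall>v\<in>pverts F. u \<noteq> v \<longrightarrow> (u, v) \<notin> parcs F \<longrightarrow>
     (\<exists>w. (u, w) \<in> parcs F \<and> (w, v) \<in> parcs F))"

context pair_graph
begin

lemma
  assumes "common_neighbors G"
  shows common_neighbors_connected: "connected_pair_graph G"
    and common_neighbors_hop_dist:
      "u \<in> pverts G \<Longrightarrow> v \<in> pverts G \<Longrightarrow> hop_dist G u v = two_step_dist G u v"
proof -
  have 1: "two_step_dist G v v = 0" for v by (simp add: two_step_dist_def)
  have 2: "two_step_dist G u v \<le> Suc (two_step_dist G w v)" if "(u, w) \<in> parcs G" for u w v
    using that by (auto simp: two_step_dist_def)
  have 3: "\<exists>w. (u, w) \<in> parcs G \<and> two_step_dist G w v < two_step_dist G u v"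
    if uv: "u \<in> pverts G" "v \<in> pverts G" "u \<noteq> v" for u v
  proof (cases "(u, v) \<in> parcs G")
    case True
    then show ?thesis using uv by (intro exI[of _ v]) (simp add: two_step_dist_def)
  next
    case False
    then obtain w where "(u, w) \<in> parcs G" "(w, v) \<in> parcs G"
      using assms uv unfolding common_neighbors_def by blast
    then show ?thesis using uv False by (intro exI[of _ w]) (simp add: two_step_dist_def)
  qed
  show "connected_pair_graph G"
    by (rule hop_dist_unique(1)[of "two_step_dist G"]) (use 1 2 3 in auto)
  show "hop_dist G u v = two_step_dist G u v" if "u \<in> pverts G" "v \<in> pverts G"
    by (rule hop_dist_unique(2)[of "two_step_dist G"]) (use 1 2 3 that in auto)
qed

lemma common_neighbors_mutually_max_distant:
  assumes "common_neighbors G" "u \<in> pverts G" "v \<in> pverts G"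
  shows "mutually_max_distant G u v \<longleftrightarrow> nonadjacent_or_twins G u v"
  using two_step_dist_max_iff[OF assms(2,3)] assms wellformed'
  by (auto simp: mutually_max_distant_def common_neighbors_hop_dist)

lemma common_neighbors_strong_metric_dim:
  assumes "common_neighbors G"
  shows "strong_metric_dim G =
    card (pverts G) - independence_number (pverts G) (nonadjacent_or_twins G)"
  using connected_pair_graph.strong_metric_dim_eq[OF common_neighbors_connected[OF assms]]
    independence_number_cong[of "pverts G", OF common_neighbors_mutually_max_distant[OF assms]]
  by simp

text \<open>Distances are infinite between vertices not joined by a walk, so a diameter of at most two also
  forces walks to exist; a walk of length less than three between distinct nonadjacent vertices has a
  middle vertex.\<close>

lemma gdiameter_le_2_iff:
  assumes "pverts G \<noteq> {}"
  shows "gdiameter G \<le> 2 \<longleftrightarrow> common_neighbors G"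
proof -
  let ?D = "{gdist G u v | u v. u \<in> pverts G \<and> v \<in> pverts G}"
  have "?D = (\<lambda>(u, v). gdist G u v) ` (pverts G \<times> pverts G)" by auto
  then have "finite ?D" using pair_finite_verts by simp
  moreover have "?D \<noteq> {}" using assms by auto
  ultimately have "gdiameter G \<le> 2 \<longleftrightarrow> (\<forall>u\<in>pverts G. \<forall>v\<in>pverts G. gdist G u v \<le> 2)"
    unfolding gdiameter_def by (subst Max_le_iff) auto
  also have "\<dots> \<longleftrightarrow> common_neighbors G"
  proof
    assume "common_neighbors G"
    then show "\<forall>u\<in>pverts G. \<forall>v\<in>pverts G. gdist G u v \<le> 2"
      using connected_pair_graph.gdist_eq_hop_dist[OF common_neighbors_connected]
      by (auto simp: common_neighbors_hop_dist two_step_dist_def)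
  next
    assume le: "\<forall>u\<in>pverts G. \<forall>v\<in>pverts G. gdist G u v \<le> 2"
    show "common_neighbors G" unfolding common_neighbors_def
    proof (intro ballI impI)
      fix u v assume uv: "u \<in> pverts G" "v \<in> pverts G" "u \<noteq> v" "(u, v) \<notin> parcs G"
      have "gdist G u v \<le> 2" using le uv by blast
      also have "\<dots> < ereal (real 3)" by simp
      finally have "gdist G u v < ereal (real 3)" .
      then obtain p where p: "awalk u p v" "length p < 3"
        unfolding gdist_eq_INF_length[OF pair_graph] by (force simp: INF_less_iff)
      then obtain e q where p1: "p = e # q" using uv by (cases p) (auto simp: awalk_Nil_iff)
      then obtain e' r where "q = e' # r"
        using p uv by (cases q) (auto simp: awalk_simps)
      then have "p = [e, e']" using p p1 by simp
      then show "\<exists>w. (u, w) \<in> parcs G \<and> (w, v) \<in> parcs G"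
        using p by (cases e; cases e') (auto simp: awalk_simps)
    qed
  qed
  finally show ?thesis .
qed

end

section \<open>The join with a single vertex\<close>

text \<open>A vertex of \<open>H\<close> that is adjacent to all others would make all nonadjacent pairs have a common
  neighbour, so that the diameter would be at most two. Without
  one, the new vertex is adjacent to everything and a twin of nothing, hence isolated in the strong resolving
  graph, and it can be added to every independent set of \<open>H\<close>.\<close>

lemma strong_metric_dim_K1_join:
  assumes "pair_graph H" and diam: "\<not> common_neighbors H"
  shows "strong_metric_dim (K1_join H) =
    card (pverts H) - independence_number (pverts H) (nonadjacent_or_twins H)"
proof -
  interpret H: pair_graph H by fact
  interpret K: pair_graph "K1_join H" using pair_graph_K1_join[OF assms(1)] .
  let ?V = "pverts H" and ?R = "nonadjacent_or_twins H"
  let ?V' = "pverts (K1_join H)" and ?R' = "nonadjacent_or_twins (K1_join H)"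
  have cn: "common_neighbors (K1_join H)"
    by (auto simp: common_neighbors_def K1_join_def)
  have V': "?V' = insert None (Some ` ?V)" by (simp add: K1_join_def)
  have nb_None: "closed_neighborhood (K1_join H) None = ?V'"
    by (auto simp: closed_neighborhood_def K1_join_def)
  have nb_Some: "closed_neighborhood (K1_join H) (Some b) =
      insert None (Some ` closed_neighborhood H b)" if "b \<in> ?V" for b
    using that by (auto simp: closed_neighborhood_def K1_join_def)
  have not_dom: "closed_neighborhood H b \<noteq> ?V" if "b \<in> ?V" for b
  proof
    assume "closed_neighborhood H b = ?V"
    then have "(b, u) \<in> parcs H" if "u \<in> ?V" "u \<noteq> b" for u
      using that by (auto simp: closed_neighborhood_def)
    then have "common_neighbors H"
      unfolding common_neighbors_def using H.arcs_symmetric by metis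
    with diam show False ..
  qed
  have R_None: "\<not> ?R' None (Some b)" "\<not> ?R' (Some b) None" "\<not> ?R' None None" if "b \<in> ?V" for b
  proof -
    have "Some ` closed_neighborhood H b \<noteq> Some ` ?V"
      using not_dom[OF that] by (simp add: inj_image_eq_iff)
    then have "closed_neighborhood (K1_join H) (Some b) \<noteq> closed_neighborhood (K1_join H) None"
      unfolding nb_None nb_Some[OF that] V' by (auto simp: set_eq_iff)
    moreover have "(None, Some b) \<in> parcs (K1_join H)" "(Some b, None) \<in> parcs (K1_join H)"
      using that by (auto simp: K1_join_def)
    ultimately show "\<not> ?R' None (Some b)" "\<not> ?R' (Some b) None" "\<not> ?R' None None"
      by (auto simp: nonadjacent_or_twins_def)
  qed
  have R_Some: "?R' (Some b) (Some d) \<longleftrightarrow> ?R b d" if "b \<in> ?V" "d \<in> ?V" for b d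
  proof -
    have "insert None (Some ` X) = insert None (Some ` Y) \<longleftrightarrow> X = Y" for X Y :: "'a set"
      by (auto simp: set_eq_iff)
    then show ?thesis
      by (simp add: nonadjacent_or_twins_def nb_Some that) (auto simp: K1_join_def)
  qed
  have fin: "finite ?V" "finite ?V'" using H.pair_finite_verts K.pair_finite_verts by auto
  have "independence_number ?V' ?R' = Suc (independence_number ?V ?R)"
  proof (rule antisym)
    obtain I where I: "I \<in> independent_sets ?V' ?R'" "card I = independence_number ?V' ?R'"
      using independence_number_attained fin by blast
    let ?J = "{b. Some b \<in> I}"
    have "?J \<subseteq> ?V" using I V' by (auto simp: independent_sets_def)
    moreover have "\<not> ?R b d" if "b \<in> ?J" "d \<in> ?J" for b d
      using I(1) that R_Some[of b d] \<open>?J \<subseteq> ?V\<close> unfolding independent_sets_def by blast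
    ultimately have "?J \<in> independent_sets ?V ?R" by (simp add: independent_sets_def)
    then have "card ?J \<le> independence_number ?V ?R" using independence_number_ge fin by blast
    moreover have "card I \<le> Suc (card ?J)"
    proof -
      have "I \<subseteq> insert None (Some ` ?J)"
      proof
        fix x assume "x \<in> I"
        then show "x \<in> insert None (Some ` ?J)" by (cases x) auto
      qed
      then have "card I \<le> card (insert None (Some ` ?J))"
        using finite_subset[OF \<open>?J \<subseteq> ?V\<close> fin(1)] by (intro card_mono) auto
      also have "\<dots> = Suc (card ?J)"
        using finite_subset[OF \<open>?J \<subseteq> ?V\<close> fin(1)] by (simp add: card_image image_iff)
      finally show ?thesis .
    qed
    ultimately show "independence_number ?V' ?R' \<le> Suc (independence_number ?V ?R)"
      using I by simp
  next
    obtain J where J: "J \<in> independent_sets ?V ?R" "card J = independence_number ?V ?R"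
      using independence_number_attained fin by blast
    then have "J \<subseteq> ?V" by (simp add: independent_sets_def)
    moreover have "\<not> ?R' None None" by (simp add: nonadjacent_or_twins_def)
    ultimately have "insert None (Some ` J) \<in> independent_sets ?V' ?R'"
      unfolding V' independent_sets_def using J(1) R_None R_Some
      by (auto simp: independent_sets_def subset_iff)
    then have "card (insert None (Some ` J)) \<le> independence_number ?V' ?R'"
      using independence_number_ge fin by blast
    then show "Suc (independence_number ?V ?R) \<le> independence_number ?V' ?R'"
      using J finite_subset[OF \<open>J \<subseteq> ?V\<close>] fin by (simp add: card_image image_iff)
  qed
  moreover have "card ?V' = Suc (card ?V)" unfolding V' using fin by (simp add: card_image image_iff)
  ultimately show ?thesis by (simp add: K.common_neighbors_strong_metric_dim[OF cn])
qed

section \<open>The lexicographic product\<close>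

text \<open>A vertex isolated in \<open>G\<close> would leave its fibre cut off from the rest of the product, so that
  the distances in this fibre would be those of \<open>H\<close>; hence every vertex of \<open>G\<close> is required to have a neighbour.\<close>

context
  fixes G :: "'a pair_pre_digraph" and H :: "'b pair_pre_digraph"
  assumes G: "connected_pair_graph G" and H: "pair_graph H"
    and no_isolated: "\<And>a. a \<in> pverts G \<Longrightarrow> \<exists>a'. (a, a') \<in> parcs G"
begin

interpretation G: connected_pair_graph G by (fact G)
interpretation H: pair_graph H by (fact H)
interpretation L: pair_graph "lex_product G H"
  by (rule pair_graph_lex_product) (fact G.pair_graph H.pair_graph)+

lemma pverts_lex_product: "pverts (lex_product G H) = pverts G \<times> pverts H"
  by (simp add: lex_product_def)

lemma parcs_lex_product: "((a, b), (c, d)) \<in> parcs (lex_product G H) \<longleftrightarrow>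
    b \<in> pverts H \<and> d \<in> pverts H \<and>
    ((a, c) \<in> parcs G \<or> (a \<in> pverts G \<and> a = c \<and> (b, d) \<in> parcs H))"
  by (auto simp: lex_product_def dest: G.wellformed')

definition lex_dist :: "'a \<times> 'b \<Rightarrow> 'a \<times> 'b \<Rightarrow> nat" where
  "lex_dist = (\<lambda>(a, b) (c, d). if a = c then two_step_dist H b d else hop_dist G a c)"

lemma
  shows connected_lex_product: "connected_pair_graph (lex_product G H)"
    and hop_dist_lex_product: "x \<in> pverts (lex_product G H) \<Longrightarrow> y \<in> pverts (lex_product G H) \<Longrightarrow>
      hop_dist (lex_product G H) x y = lex_dist x y"
proof -
  have 1: "lex_dist z z = 0" for z
    by (simp add: lex_dist_def two_step_dist_def split: prod.splits)
  have 2: "lex_dist x z \<le> Suc (lex_dist y z)"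
    if xy: "(x, y) \<in> parcs (lex_product G H)" and z: "z \<in> pverts (lex_product G H)" for x y z
  proof -
    obtain a b c d e f where [simp]: "x = (a, b)" "y = (c, d)" "z = (e, f)" by (metis surj_pair)
    have ts: "two_step_dist H b f \<le> 2" by (simp add: two_step_dist_def)
    show ?thesis
    proof (cases "(a, c) \<in> parcs G")
      case True
      have V: "a \<in> pverts G" "c \<in> pverts G" "e \<in> pverts G"
        using G.wellformed'[OF True] z by (auto simp: pverts_lex_product)
      have "hop_dist G a e \<le> Suc (hop_dist G c e)"
        using G.hop_dist_triangle[of a c e] G.hop_dist_arc[OF True] V by simp
      moreover have "hop_dist G c e > 0" if "c \<noteq> e" using G.hop_dist_pos V that by blast
      moreover have "a \<noteq> c" using G.no_loops' True by blast
      moreover have "hop_dist G c c = 0" using V G.hop_dist_refl by blast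
      ultimately show ?thesis using ts by (auto simp: lex_dist_def)
    next
      case False
      then have "a = c" "(b, d) \<in> parcs H" using xy by (auto simp: parcs_lex_product)
      then show ?thesis by (auto simp: lex_dist_def two_step_dist_def)
    qed
  qed
  have 3: "\<exists>w. (x, w) \<in> parcs (lex_product G H) \<and> lex_dist w z < lex_dist x z"
    if xz: "x \<in> pverts (lex_product G H)" "z \<in> pverts (lex_product G H)" "x \<noteq> z" for x z
  proof -
    obtain a b e f where [simp]: "x = (a, b)" "z = (e, f)" by (metis surj_pair)
    have V: "a \<in> pverts G" "e \<in> pverts G" "b \<in> pverts H" "f \<in> pverts H"
      using xz by (auto simp: pverts_lex_product)
    show ?thesis
    proof (cases "a = e")
      case True
      show ?thesis
      proof (cases "(b, f) \<in> parcs H")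
        case True
        then show ?thesis using \<open>a = e\<close> V xz
          by (intro exI[of _ z]) (auto simp: parcs_lex_product lex_dist_def two_step_dist_def)
      next
        case False
        \<comment> \<open>Nonadjacent vertices of one fibre have a common neighbour in any neighbouring fibre.\<close>
        obtain a' where a': "(a, a') \<in> parcs G" using no_isolated V by blast
        then have "hop_dist G a' a \<le> 1" "a' \<noteq> a"
          using G.hop_dist_arc G.arcs_symmetric G.no_loops' by blast+
        then show ?thesis using \<open>a = e\<close> False V xz a'
          by (intro exI[of _ "(a', b)"]) (auto simp: parcs_lex_product lex_dist_def two_step_dist_def)
      qed
    next
      case False
      then obtain c where c: "(a, c) \<in> parcs G" "hop_dist G a e = Suc (hop_dist G c e)"
        using G.first_step V by metis
      then show ?thesis using False V
        by (intro exI[of _ "(c, f)"]) (auto simp: parcs_lex_product lex_dist_def two_step_dist_def)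
    qed
  qed
  show "connected_pair_graph (lex_product G H)"
    by (rule L.hop_dist_unique(1)[of lex_dist]) (use 1 2 3 in auto)
  show "hop_dist (lex_product G H) x y = lex_dist x y"
    if "x \<in> pverts (lex_product G H)" "y \<in> pverts (lex_product G H)"
    by (rule L.hop_dist_unique(2)[of lex_dist]) (use 1 2 3 that in auto)
qed

lemma mutually_max_distant_lex_product_iff:
  assumes "x \<in> pverts (lex_product G H)" "y \<in> pverts (lex_product G H)"
  shows "mutually_max_distant (lex_product G H) x y \<longleftrightarrow> x \<noteq> y \<and>
     (\<forall>w. (x, w) \<in> parcs (lex_product G H) \<longrightarrow> lex_dist w y \<le> lex_dist x y) \<and>
     (\<forall>w. (y, w) \<in> parcs (lex_product G H) \<longrightarrow> lex_dist x w \<le> lex_dist x y)"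
  unfolding mutually_max_distant_def using assms L.wellformed'
  by (auto simp: hop_dist_lex_product)

text \<open>Within a fibre, the neighbouring fibres are at distance one and impose no condition, so only the
  truncated distance of \<open>H\<close> matters. Across fibres, moving inside the own fibre changes no distance.
  A move to a neighbouring fibre changes the distance as in \<open>G\<close>, unless it reaches the other
  vertex's fibre, where distances of \<open>H\<close> appear; the projections being nonadjacent
  excludes this.\<close>

lemma mutually_max_distant_lex_product:
  assumes no_twins: "\<not> (\<exists>x y. true_twins G x y)"
    and V: "a \<in> pverts G" "b \<in> pverts H" "c \<in> pverts G" "d \<in> pverts H"
  shows "mutually_max_distant (lex_product G H) (a, b) (c, d) \<longleftrightarrow>
    mutually_max_distant G a c \<or> (a = c \<and> nonadjacent_or_twins H b d)"
proof -
  have mmd_L: "mutually_max_distant (lex_product G H) (a, b) (c, d) \<longleftrightarrow> (a, b) \<noteq> (c, d) \<and>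
     (\<forall>w. ((a, b), w) \<in> parcs (lex_product G H) \<longrightarrow> lex_dist w (c, d) \<le> lex_dist (a, b) (c, d)) \<and>
     (\<forall>w. ((c, d), w) \<in> parcs (lex_product G H) \<longrightarrow> lex_dist (a, b) w \<le> lex_dist (a, b) (c, d))"
    using V by (intro mutually_max_distant_lex_product_iff) (auto simp: pverts_lex_product)
  show ?thesis
  proof (cases "a = c")
    case True
    have "hop_dist G x y \<le> two_step_dist H b d" if "(x, y) \<in> parcs G" "b \<noteq> d" for x y
      using G.hop_dist_arc[OF that(1)] that(2) by (simp add: two_step_dist_def)
    moreover have "(c, c) \<notin> parcs G" using G.no_loops' by blast
    ultimately have "mutually_max_distant (lex_product G H) (a, b) (c, d) \<longleftrightarrow> b \<noteq> d \<and>
      (\<forall>w. (b, w) \<in> parcs H \<longrightarrow> two_step_dist H w d \<le> two_step_dist H b d) \<and>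
      (\<forall>w. (d, w) \<in> parcs H \<longrightarrow> two_step_dist H b w \<le> two_step_dist H b d)"
      unfolding mmd_L split_paired_All parcs_lex_product
      using True V G.arcs_symmetric H.wellformed'
      by (auto simp: lex_dist_def)
    also have "\<dots> \<longleftrightarrow> nonadjacent_or_twins H b d" using V by (intro H.two_step_dist_max_iff)
    finally show ?thesis using True by (simp add: mutually_max_distant_def)
  next
    case False
    have "mutually_max_distant G a c" if "mutually_max_distant (lex_product G H) (a, b) (c, d)"
      unfolding mutually_max_distant_def
    proof (intro conjI allI impI)
      fix w assume w: "(a, w) \<in> parcs G"
      then have "((a, b), (w, b)) \<in> parcs (lex_product G H)"
        using V by (simp add: parcs_lex_product)
      then have "lex_dist (w, b) (c, d) \<le> lex_dist (a, b) (c, d)"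
        using that unfolding mmd_L by blast
      then show "hop_dist G w c \<le> hop_dist G a c"
        using False V G.hop_dist_refl by (auto simp: lex_dist_def split: if_splits)
    next
      fix w assume w: "(c, w) \<in> parcs G"
      then have "((c, d), (w, d)) \<in> parcs (lex_product G H)"
        using V by (simp add: parcs_lex_product)
      then have "lex_dist (a, b) (w, d) \<le> lex_dist (a, b) (c, d)"
        using that unfolding mmd_L by blast
      then show "hop_dist G a w \<le> hop_dist G a c"
        using False V G.hop_dist_refl by (auto simp: lex_dist_def split: if_splits)
    qed (fact False)
    moreover have "mutually_max_distant (lex_product G H) (a, b) (c, d)"
      if mmd: "mutually_max_distant G a c"
    proof -
      have "(a, c) \<notin> parcs G"
        using G.adjacent_mutually_max_distant_twins mmd no_twins by blast
      moreover from this have "(c, a) \<notin> parcs G" using G.arcs_symmetric by blast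
      ultimately show ?thesis
        unfolding mmd_L split_paired_All parcs_lex_product
        using False mmd by (auto simp: lex_dist_def mutually_max_distant_def)
    qed
    ultimately show ?thesis using False by blast
  qed
qed

lemma strong_metric_dim_lex_product:
  assumes "\<not> (\<exists>x y. true_twins G x y)"
  shows "strong_metric_dim (lex_product G H) = card (pverts G) * card (pverts H) -
    independence_number (pverts G) (mutually_max_distant G) *
    independence_number (pverts H) (nonadjacent_or_twins H)"
proof -
  have "independence_number (pverts G \<times> pverts H) (mutually_max_distant (lex_product G H)) =
    independence_number (pverts G \<times> pverts H)
      (\<lambda>(a, b) (c, d). mutually_max_distant G a c \<or> (a = c \<and> nonadjacent_or_twins H b d))"
    by (rule independence_number_cong)
       (auto simp: mutually_max_distant_lex_product[OF assms])
  also have "\<dots> = independence_number (pverts G) (mutually_max_distant G) *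
    independence_number (pverts H) (nonadjacent_or_twins H)"
    by (rule independence_number_lex)
       (auto simp: mutually_max_distant_def G.pair_finite_verts H.pair_finite_verts)
  finally show ?thesis
    using connected_pair_graph.strong_metric_dim_eq[OF connected_lex_product]
    by (simp add: pverts_lex_product card_cartesian_product)
qed

end

theorem theorem10:
  fixes G :: "'a pair_pre_digraph" and H :: "'b pair_pre_digraph" and n n' :: nat
  assumes "pair_graph G" and "connected G" and "card (pverts G) = n" and "n \<ge> 2"
    and "pair_graph H" and "card (pverts H) = n'" and "n' \<ge> 2"
    and "\<not> (\<exists>x y. true_twins G x y)"
  shows "(gdiameter H \<le> 2 \<longrightarrow>
           int (strong_metric_dim (lex_product G H)) =
             int n * int (strong_metric_dim H) + int n' * int (strong_metric_dim G)
             - int (strong_metric_dim G) * int (strong_metric_dim H)) \<and>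
         (gdiameter H > 2 \<longrightarrow>
           int (strong_metric_dim (lex_product G H)) =
             int n * int (strong_metric_dim (K1_join H)) + int n' * int (strong_metric_dim G)
             - int (strong_metric_dim G) * int (strong_metric_dim (K1_join H)))"
proof -
  interpret H: pair_graph H by fact
  interpret G: connected_pair_graph G
    using pair_graph.connected_imp_connected_pair_graph assms by blast
  have no_isolated: "\<exists>a'. (a, a') \<in> parcs G" if "a \<in> pverts G" for a
  proof -
    have "\<not> pverts G \<subseteq> {a}" using assms card_mono[of "{a}" "pverts G"] by auto
    then obtain c where "c \<in> pverts G" "a \<noteq> c" by blast
    then show ?thesis using G.first_step that by metis
  qed
  let ?\<alpha> = "independence_number (pverts G) (mutually_max_distant G)"
  let ?\<beta> = "independence_number (pverts H) (nonadjacent_or_twins H)"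
  have \<alpha>: "?\<alpha> \<le> n" and \<beta>: "?\<beta> \<le> n'"
    using independence_number_le_card G.pair_finite_verts H.pair_finite_verts assms by blast+
  have dim_G: "int (strong_metric_dim G) = int n - int ?\<alpha>"
    using G.strong_metric_dim_eq assms \<alpha> by (simp add: of_nat_diff)
  have dim_L: "int (strong_metric_dim (lex_product G H)) = int n * int n' - int ?\<alpha> * int ?\<beta>"
    using strong_metric_dim_lex_product[OF G.connected_pair_graph_axioms assms(5) no_isolated assms(8)]
      mult_le_mono[OF \<alpha> \<beta>] assms(3,6) by (simp add: of_nat_diff)
  \<comment> \<open>The claimed expression is \<open>n n' - (n - dim G) (n' - k)\<close>, multiplied out.\<close>
  have formula: "int (strong_metric_dim (lex_product G H)) =
      int n * int k + int n' * int (strong_metric_dim G) - int (strong_metric_dim G) * int k"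
    if "k = n' - ?\<beta>" for k
    using that \<beta> unfolding dim_L dim_G by (simp add: of_nat_diff algebra_simps)
  have "gdiameter H \<le> 2 \<longleftrightarrow> common_neighbors H"
    using H.gdiameter_le_2_iff assms(6,7) by fastforce
  then show ?thesis
    using formula H.common_neighbors_strong_metric_dim strong_metric_dim_K1_join[OF assms(5)]
      assms(6) by (simp add: not_le[symmetric])
qed

end
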